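(* Let $n\ge 1$ and let $(P_e)_{e\ge 0}$ be the Pell sequence, $P_0=0$, $P_1=1$, $P_{e+1}=2P_e+P_{e-1}$. Let $T_n=(a_{i,j})_{1\le i,j\le n}$ with $a_{i,j}=2^{i+j-n-1}\binom{i-1}{n-j}$, and let $v=((-1)^nP_{n-1},(-1)^{n-1}P_{n-2},\ldots,-P_0)^t$, i.e. $v_j=(-1)^{n+1-j}P_{n-j}$. Then: (1) for every integer $e\ge 0$, $T_n^{e+1}v=(P_{(n-1)e},P_{(n-1)e+1},\ldots,P_{(n-1)(e+1)})^t$; (2) writing $T_n^e=(a^{(e)}_{i,j})$, for every $e\ge1$ and all $2\le i,j\le n$, \[P_{e-1}a^{(e)}_{i,j}+P_e a^{(e)}_{i,j-1}=P_e a^{(e)}_{i-1,j}+P_{e+1}a^{(e)}_{i-1,j-1};\] (3) $T_n$ is the unique $n\times n$ matrix $(b_{i,j})$ such that $b_{1,j}=0$ for $1\le j<n$, $b_{i,n}=2^{i-1}$ for $1\le i\le n$, and $b_{i,j}=2b_{i-1,j}+b_{i-1,j+1}$ for $2\le i\le n$, $1\le j\le n-1$.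
   Context: Binomial coefficients $\binom{a}{b}$ are $0$ when $b<0$ or $b>a$; whenever $\binom{i-1}{n-j}\neq 0$ the exponent $i+j-n-1$ is nonnegative, so all entries of $T_n$ are integers. *)

theory Defs
  imports Jordan_Normal_Form.Matrix
begin

fun pell :: "nat \<Rightarrow> int" where
  "pell 0 = 0"
| "pell (Suc 0) = 1"
| "pell (Suc (Suc e)) = 2 * pell (Suc e) + pell e"

text \<open>Library matrices and vectors are indexed from 0; the following accesses a matrix entry
  with row and column numbers counted from 1. It is meaningful only for positive numbers.\<close>

abbreviation entry :: "'a mat \<Rightarrow> nat \<Rightarrow> nat \<Rightarrow> 'a" where
  "entry A i j \<equiv> A $$ (i - 1, j - 1)"

text \<open>The arguments \<open>i, j\<close> of the next definition run from 1 to \<open>n\<close>. The exponent is truncated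
  only if \<open>i + j < n + 1\<close>, that is \<open>i - 1 < n - j\<close>, and then the binomial coefficient is zero.\<close>

definition pell_entry :: "nat \<Rightarrow> nat \<Rightarrow> nat \<Rightarrow> int" where
  "pell_entry n i j = 2 ^ (i + j - n - 1) * int ((i - 1) choose (n - j))"

definition pell_mat :: "nat \<Rightarrow> int mat" where
  "pell_mat n = mat n n (\<lambda>(i, j). pell_entry n (i + 1) (j + 1))"

text \<open>Again \<open>j\<close> runs from 1 to \<open>n\<close>.\<close>

definition pell_vec_entry :: "nat \<Rightarrow> nat \<Rightarrow> int" where
  "pell_vec_entry n j = (- 1) ^ (n + 1 - j) * pell (n - j)"

definition pell_vec :: "nat \<Rightarrow> int vec" where
  "pell_vec n = vec n (\<lambda>j. pell_vec_entry n (j + 1))"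

definition pell_recurrence :: "nat \<Rightarrow> 'a::comm_ring_1 mat \<Rightarrow> bool" where
  "pell_recurrence n B \<longleftrightarrow>
     (\<forall>j. 1 \<le> j \<and> j < n \<longrightarrow> entry B 1 j = 0) \<and>
     (\<forall>i. 1 \<le> i \<and> i \<le> n \<longrightarrow> entry B i n = 2 ^ (i - 1)) \<and>
     (\<forall>i j. 2 \<le> i \<and> i \<le> n \<and> 1 \<le> j \<and> j \<le> n - 1 \<longrightarrow>
        entry B i j = 2 * entry B (i - 1) j + entry B (i - 1) (j + 1))"

end

theory Submission
  imports Defs "HOL-Computational_Algebra.Polynomial"
begin

text \<open>With \<open>N = n - 1\<close>, the matrix \<open>T\<^sub>n\<close> is the \<open>N\<close>-th symmetric power of the Pell matrix with
  rows \<open>(0, 1)\<close> and \<open>(1, 2)\<close>. Hence, with both indices counted from 0, row \<open>i\<close> of \<open>T\<^sub>n\<^sup>e\<close> is the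
  coefficient sequence of \<open>(P\<^bsub>e-1\<^esub> + P\<^bsub>e\<^esub> x)\<^bsup>N-i\<^esup> (P\<^bsub>e\<^esub> + P\<^bsub>e+1\<^esub> x)\<^bsup>i\<^esup>\<close>, from which (2) is read off.
  For (1), \<open>T\<^sub>n\<close> shifts by \<open>N\<close> every window of length \<open>n\<close> of a two-sided sequence that satisfies
  the Pell recurrence, and \<open>v\<close> is the window of the two-sided Pell sequence that starts
  at \<open>-N\<close>.\<close>

section \<open>The Pell sequence at negative indices, and iterated shifts\<close>

definition pell_int :: "int \<Rightarrow> int" where
  "pell_int k = (if k \<ge> 0 then pell (nat k) else (- 1) ^ (nat (- k) + 1) * pell (nat (- k)))"

lemma pell_int_of_nat [simp]: "pell_int (int m) = pell m"
  by (simp add: pell_int_def)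

lemma pell_int_minus_of_nat: "pell_int (- int m) = (- 1) ^ (m + 1) * pell m"
  by (cases "m = 0") (simp_all add: pell_int_def)

lemma pell_int_rec: "pell_int (k + 2) = 2 * pell_int (k + 1) + pell_int k"
proof -
  \<comment> \<open>Only k = -1 has neighbours of both signs. For k below -1 all three indices are
    at most 0, and the formula for negative indices also covers 0 because P_0 = 0.\<close>
  consider m where "k = int m" | "k = - 1" | m where "k = - int (m + 2)"
  proof -
    have "k = int (nat k) \<or> k = - 1 \<or> k = - int (nat (- k - 2) + 2)"
      by linarith
    then show thesis using that by blast
  qed
  then show ?thesis
  proof cases
    case (1 m)
    then have "k + 1 = int (Suc m)" "k + 2 = int (Suc (Suc m))" by simp_all
    then show ?thesis using 1 by (simp only: pell_int_of_nat pell.simps)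
  next
    case 2
    then show ?thesis by (simp add: pell_int_def)
  next
    case (3 m)
    then have "k = - int (Suc (Suc m))" "k + 1 = - int (Suc m)" "k + 2 = - int m" by simp_all
    then show ?thesis by (simp only: pell_int_minus_of_nat) (simp add: algebra_simps)
  qed
qed

text \<open>For the shift operator E the recurrence reads E = 2 + E^(-1), and the sum is the
  binomial expansion of E^i. The inverse powers are the reason for working with two-sided
  sequences.\<close>

lemma binomial_sum_shift:
  fixes f :: "int \<Rightarrow> 'a::comm_ring_1"
  assumes f: "\<And>x. f (x + 2) = 2 * f (x + 1) + f x"
  shows "(\<Sum>l\<le>i. of_nat (i choose l) * 2 ^ (i - l) * f (x - int l)) = f (x + int i)"
proof (induction i arbitrary: x)
  case (Suc i)
  have "(\<Sum>l\<le>Suc i. of_nat (Suc i choose l) * 2 ^ (Suc i - l) * f (x - int l))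
      = 2 ^ Suc i * f x
        + (\<Sum>l\<le>i. of_nat (Suc i choose Suc l) * 2 ^ (i - l) * f (x - 1 - int l))"
    by (subst sum.atMost_Suc_shift) (simp add: algebra_simps)
  \<comment> \<open>Pascal's rule splits the sum: the bracket becomes twice the induction hypothesis
    at x, the rest is the induction hypothesis at x - 1.\<close>
  also have "\<dots> = (2 ^ Suc i * f x
        + (\<Sum>l\<le>i. of_nat (i choose Suc l) * 2 ^ (i - l) * f (x - 1 - int l)))
        + (\<Sum>l\<le>i. of_nat (i choose l) * 2 ^ (i - l) * f (x - 1 - int l))"
    by (simp add: sum.distrib algebra_simps)
  also have "2 ^ Suc i * f x
        + (\<Sum>l\<le>i. of_nat (i choose Suc l) * 2 ^ (i - l) * f (x - 1 - int l))
      = (\<Sum>l\<le>Suc i. of_nat (i choose l) * 2 ^ (Suc i - l) * f (x - int l))"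
    by (subst sum.atMost_Suc_shift) (simp add: algebra_simps)
  also have "\<dots> = 2 * (\<Sum>l\<le>i. of_nat (i choose l) * 2 ^ (i - l) * f (x - int l))"
    by (simp add: binomial_eq_0 sum_distrib_left Suc_diff_le algebra_simps)
  finally show ?case
    using f[of "x + int i - 1"] unfolding Suc.IH by (simp add: algebra_simps)
qed simp

section \<open>Rows of the matrix and their action on windows\<close>

lemma pell_mat_carrier [simp]: "pell_mat n \<in> carrier_mat n n"
  by (simp add: pell_mat_def)

lemma pell_mat_dim [simp]: "dim_row (pell_mat n) = n" "dim_col (pell_mat n) = n"
  by (simp_all add: pell_mat_def)

lemma pell_mat_index:
  assumes "i < n" "j < n"
  shows "pell_mat n $$ (i, j) = 2 ^ (i + j - (n - 1)) * int (i choose (n - 1 - j))"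
proof -
  have "i + 1 + (j + 1) - n - 1 = i + j - (n - 1)" "n - (j + 1) = n - 1 - j"
    using assms by linarith+
  then show ?thesis using assms by (simp add: pell_mat_def pell_entry_def)
qed

text \<open>Reading row i from right to left (j = n - 1 - l) turns it into the coefficients of a
  binomial expansion. The ring is left general because g takes integer values for windows and
  polynomial values for matrix powers.\<close>

lemma sum_pell_mat_row:
  fixes g :: "nat \<Rightarrow> 'a::comm_ring_1"
  assumes "i < n"
  shows "(\<Sum>j<n. of_int (pell_mat n $$ (i, j)) * g j)
       = (\<Sum>l\<le>i. of_nat (i choose l) * 2 ^ (i - l) * g (n - 1 - l))"
proof -
  have "(\<Sum>j<n. of_int (pell_mat n $$ (i, j)) * g j)
      = (\<Sum>l<n. of_int (pell_mat n $$ (i, n - Suc l)) * g (n - Suc l))"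
    by (rule sum.nat_diff_reindex[symmetric])
  also have "\<dots> = (\<Sum>l<n. of_nat (i choose l) * 2 ^ (i - l) * g (n - 1 - l))"
  proof (rule sum.cong)
    fix l assume "l \<in> {..<n}"
    then have "i + (n - Suc l) - (n - 1) = i - l" "n - 1 - (n - Suc l) = l" "n - Suc l < n"
      by auto
    then show "of_int (pell_mat n $$ (i, n - Suc l)) * g (n - Suc l)
        = of_nat (i choose l) * 2 ^ (i - l) * g (n - 1 - l)"
      using assms by (simp add: pell_mat_index)
  qed simp
  also have "\<dots> = (\<Sum>l\<le>i. of_nat (i choose l) * 2 ^ (i - l) * g (n - 1 - l))"
    by (rule sum.mono_neutral_right) (use assms in \<open>auto simp: binomial_eq_0\<close>)
  finally show ?thesis .
qed

text \<open>Entry i of the product is the sum of \<open>binomial_sum_shift\<close> based at x + n -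
  1, the position of the last entry of the window.\<close>

lemma pell_mat_mult_window:
  assumes f: "\<And>x. f (x + 2) = 2 * f (x + 1) + f x"
  shows "pell_mat n *\<^sub>v vec n (\<lambda>j. f (x + int j)) = vec n (\<lambda>i. f (x + int (n - 1) + int i))"
proof (rule eq_vecI)
  fix i assume "i < dim_vec (vec n (\<lambda>i. f (x + int (n - 1) + int i)))"
  then have i: "i < n" by simp
  have "(pell_mat n *\<^sub>v vec n (\<lambda>j. f (x + int j))) $ i
      = (\<Sum>j<n. of_int (pell_mat n $$ (i, j)) * f (x + int j))"
    using i by (simp add: scalar_prod_def lessThan_atLeast0)
  also have "\<dots> = (\<Sum>l\<le>i. of_nat (i choose l) * 2 ^ (i - l) * f (x + int (n - 1 - l)))"
    by (rule sum_pell_mat_row[OF i])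
  also have "\<dots> = (\<Sum>l\<le>i. of_nat (i choose l) * 2 ^ (i - l) * f (x + int (n - 1) - int l))"
    by (rule sum.cong) (use i in \<open>auto simp: of_nat_diff algebra_simps\<close>)
  also have "\<dots> = f (x + int (n - 1) + int i)"
    by (rule binomial_sum_shift[OF f])
  finally show "(pell_mat n *\<^sub>v vec n (\<lambda>j. f (x + int j))) $ i
      = vec n (\<lambda>i. f (x + int (n - 1) + int i)) $ i"
    using i by simp
qed simp

lemma pell_mat_pow_mult_window:
  assumes f: "\<And>x. f (x + 2) = 2 * f (x + 1) + f x"
  shows "(pell_mat n ^\<^sub>m e) *\<^sub>v vec n (\<lambda>j. f (x + int j))
       = vec n (\<lambda>i. f (x + int (n - 1) * int e + int i))"
proof (induction e arbitrary: x)
  case (Suc e)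
  have "(pell_mat n ^\<^sub>m Suc e) *\<^sub>v vec n (\<lambda>j. f (x + int j))
      = (pell_mat n ^\<^sub>m e) *\<^sub>v (pell_mat n *\<^sub>v vec n (\<lambda>j. f (x + int j)))"
    by (simp add: assoc_mult_mat_vec[OF pow_carrier_mat[OF pell_mat_carrier] pell_mat_carrier])
  also have "\<dots> = vec n (\<lambda>i. f (x + int (n - 1) + int (n - 1) * int e + int i))"
    unfolding pell_mat_mult_window[OF f] by (rule Suc.IH)
  finally show ?case by (simp add: algebra_simps)
qed simp

text \<open>The signs in v are those of P_(-m) = (-1)^(m+1) P_m, with m = n - (j + 1).\<close>

lemma pell_vec_window: "pell_vec n = vec n (\<lambda>j. pell_int (- int (n - 1) + int j))"
proof (rule eq_vecI)
  fix j assume "j < dim_vec (vec n (\<lambda>j. pell_int (- int (n - 1) + int j)))"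
  then have j: "j < n" by simp
  then have "- int (n - 1) + int j = - int (n - (j + 1))" "n + 1 - (j + 1) = n - (j + 1) + 1"
    by linarith+
  then have "pell_vec_entry n (j + 1) = pell_int (- int (n - 1) + int j)"
    by (simp only: pell_vec_entry_def pell_int_minus_of_nat)
  then show "pell_vec n $ j = vec n (\<lambda>j. pell_int (- int (n - 1) + int j)) $ j"
    using j by (simp add: pell_vec_def)
qed (simp add: pell_vec_def)

lemma pell_mat_pow_mult_pell_vec:
  "(pell_mat n ^\<^sub>m (e + 1)) *\<^sub>v pell_vec n = vec n (\<lambda>k. pell ((n - 1) * e + k))"
proof -
  \<comment> \<open>One of the e + 1 shifts cancels the start -(n - 1), so all remaining indices are
    nonnegative.\<close>
  have "- int (n - 1) + int (n - 1) * int (e + 1) + int k = int ((n - 1) * e + k)" for k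
    by (simp add: distrib_left)
  then show ?thesis
    unfolding pell_vec_window pell_mat_pow_mult_window[OF pell_int_rec]
    by (simp only: pell_int_of_nat)
qed

section \<open>Powers of the matrix as symmetric powers\<close>

lemma pow_mat_Suc_left:
  assumes A: "A \<in> carrier_mat n n"
  shows "A ^\<^sub>m Suc e = A * A ^\<^sub>m e"
proof (induction e)
  case (Suc e)
  have "A ^\<^sub>m Suc (Suc e) = (A * A ^\<^sub>m e) * A"
    by (simp only: pow_mat.simps(2)[of A "Suc e"] Suc.IH)
  also have "\<dots> = A * A ^\<^sub>m Suc e"
    by (simp add: assoc_mult_mat[OF A pow_carrier_mat[OF A] A])
  finally show ?case .
qed (use A in simp)

text \<open>On forms of degree n - 1 the matrix acts as the substitution of (b, a + 2b) for (a, b);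
  after extracting the common power of b this is the binomial theorem for (a + 2b)^i.\<close>

lemma sum_pell_mat_row_homogeneous:
  fixes a b :: "'a::comm_ring_1"
  assumes i: "i < n"
  shows "(\<Sum>j<n. of_int (pell_mat n $$ (i, j)) * (a ^ (n - 1 - j) * b ^ j))
       = b ^ (n - 1 - i) * (a + 2 * b) ^ i"
proof -
  have "(\<Sum>j<n. of_int (pell_mat n $$ (i, j)) * (a ^ (n - 1 - j) * b ^ j))
      = (\<Sum>l\<le>i. of_nat (i choose l) * 2 ^ (i - l)
          * (a ^ (n - 1 - (n - 1 - l)) * b ^ (n - 1 - l)))"
    by (rule sum_pell_mat_row[OF i])
  also have "\<dots> = (\<Sum>l\<le>i. b ^ (n - 1 - i) * (of_nat (i choose l) * a ^ l * (2 * b) ^ (i - l)))"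
  proof (rule sum.cong)
    fix l assume "l \<in> {..i}"
    then have "n - 1 - (n - 1 - l) = l" "n - 1 - l = (n - 1 - i) + (i - l)"
      using i by auto
    then show "of_nat (i choose l) * 2 ^ (i - l)
          * (a ^ (n - 1 - (n - 1 - l)) * b ^ (n - 1 - l))
        = b ^ (n - 1 - i) * (of_nat (i choose l) * a ^ l * (2 * b) ^ (i - l))"
      by (simp only: power_add power_mult_distrib mult_ac)
  qed simp
  also have "\<dots> = b ^ (n - 1 - i) * (a + 2 * b) ^ i"
    by (simp only: binomial_ring sum_distrib_left)
  finally show ?thesis .
qed

text \<open>For k >= 0 this is the remainder of x^k modulo x^2 - 2x - 1. Using
  \<open>pell_int\<close> admits k = 0, where P_(-1) = 1 gives the constant 1.\<close>

definition pell_lin :: "int \<Rightarrow> int poly" where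
  "pell_lin k = [:pell_int (k - 1), pell_int k:]"

lemma pell_lin_rec: "pell_lin k + 2 * pell_lin (k + 1) = pell_lin (k + 2)"
  using pell_int_rec[of k] pell_int_rec[of "k - 1"]
  by (simp add: pell_lin_def numeral_poly algebra_simps)

lemma pell_mat_pow_index:
  assumes "i < n" "j < n"
  shows "(pell_mat n ^\<^sub>m e) $$ (i, j)
       = coeff (pell_lin (int e) ^ (n - 1 - i) * pell_lin (int e + 1) ^ i) j"
  using assms
proof (induction e arbitrary: i j)
  case 0
  \<comment> \<open>For e = 0 the row polynomial is x^i, which is row i of the identity
    matrix.\<close>
  have "pell_lin 0 = 1" "pell_lin 1 = monom 1 1"
    by (simp_all add: pell_lin_def pell_int_def one_pCons monom_altdef)
  then show ?case using 0 by (simp add: monom_power)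
next
  case (Suc e)
  let ?A = "pell_lin (int e)" and ?B = "pell_lin (int e + 1)"
  have "(pell_mat n ^\<^sub>m Suc e) $$ (i, j) = (pell_mat n * pell_mat n ^\<^sub>m e) $$ (i, j)"
    \<comment> \<open>The new factor goes on the left, so that row i of \<open>pell_mat n\<close>
      combines the rows known by induction.\<close>
    by (simp only: pow_mat_Suc_left[OF pell_mat_carrier])
  also have "\<dots> = (\<Sum>k<n. pell_mat n $$ (i, k) * (pell_mat n ^\<^sub>m e) $$ (k, j))"
    using Suc.prems by (simp add: scalar_prod_def lessThan_atLeast0)
  also have "\<dots> = (\<Sum>k<n. pell_mat n $$ (i, k) * coeff (?A ^ (n - 1 - k) * ?B ^ k) j)"
    using Suc by simp
  \<comment> \<open>Matrix entries become constant polynomials; the homogeneous row sum then applies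
    in the polynomial ring and replaces the pair (A, B) by (B, A + 2B).\<close>
  also have "\<dots> = coeff (\<Sum>k<n. of_int (pell_mat n $$ (i, k)) * (?A ^ (n - 1 - k) * ?B ^ k)) j"
    by (simp add: coeff_sum of_int_poly)
  also have "\<dots> = coeff (?B ^ (n - 1 - i) * (?A + 2 * ?B) ^ i) j"
    using Suc.prems by (simp only: sum_pell_mat_row_homogeneous)
  also have "?A + 2 * ?B = pell_lin (int (Suc e) + 1)"
    using pell_lin_rec[of "int e"] by (simp add: add_ac)
  also have "?B = pell_lin (int (Suc e))"
    by (simp add: add_ac)
  finally show ?case .
qed

text \<open>Neighbouring row polynomials R k = A^(n-1-k) B^k satisfy A * R (k+1) = B * R k. Since A
  and B are linear, comparing one coefficient on both sides gives the identity.\<close>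

lemma pell_mat_pow_recurrence:
  assumes "e \<ge> 1" "2 \<le> i" "i \<le> n" "2 \<le> j" "j \<le> n"
  shows "pell (e - 1) * entry (pell_mat n ^\<^sub>m e) i j
           + pell e * entry (pell_mat n ^\<^sub>m e) i (j - 1)
         = pell e * entry (pell_mat n ^\<^sub>m e) (i - 1) j
           + pell (e + 1) * entry (pell_mat n ^\<^sub>m e) (i - 1) (j - 1)"
proof -
  obtain i' j' where ij: "i = Suc (Suc i')" "j = Suc (Suc j')"
    using assms by (metis add_2_eq_Suc le_Suc_ex)
  let ?A = "pell_lin (int e)" and ?B = "pell_lin (int e + 1)"
  let ?R = "\<lambda>k. ?A ^ (n - 1 - k) * ?B ^ k"
  have AB: "?A = [:pell (e - 1), pell e:]" "?B = [:pell e, pell (e + 1):]"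
    using assms pell_int_of_nat[of "e - 1"] pell_int_of_nat[of "e + 1"]
    by (simp_all add: pell_lin_def of_nat_diff add_ac)
  have "n - 1 - i' = Suc (n - 1 - Suc i')"
    using assms ij by simp
  then have "?A * ?R (Suc i') = ?B * ?R i'"
    by (simp add: algebra_simps)
  then have "coeff ([:pell (e - 1), pell e:] * ?R (Suc i')) (Suc j')
      = coeff ([:pell e, pell (e + 1):] * ?R i') (Suc j')"
    by (simp only: AB)
  then have "pell (e - 1) * coeff (?R (Suc i')) (Suc j') + pell e * coeff (?R (Suc i')) j'
      = pell e * coeff (?R i') (Suc j') + pell (e + 1) * coeff (?R i') j'"
    by (simp only: mult_pCons_left coeff_add coeff_smult coeff_pCons_Suc mult_zero_left
        coeff_0 add_0_right)
  then show ?thesis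
    using assms ij by (simp add: pell_mat_pow_index)
qed

section \<open>Characterization by the recurrence\<close>

lemma pell_recurrence_of_int_pell_mat:
  assumes "n \<ge> 1"
  shows "pell_recurrence n (map_mat of_int (pell_mat n) :: 'a::comm_ring_1 mat)"
proof -
  let ?T = "map_mat of_int (pell_mat n) :: 'a mat"
  have "entry ?T i j = 2 * entry ?T (i - 1) j + entry ?T (i - 1) (j + 1)"
    if ij: "2 \<le> i" "i \<le> n" "1 \<le> j" "j \<le> n - 1" for i j
  proof -
    obtain i' where i': "i = Suc (Suc i')"
      using ij by (metis add_2_eq_Suc le_Suc_ex)
    define m where "m = n - 1 - j"
    have n: "n = Suc (j + m)"
      using ij by (simp add: m_def)
    obtain j' where j': "j = Suc j'"
      using ij by (cases j) auto
    have "pell_mat n $$ (Suc i', j')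
        = 2 * pell_mat n $$ (i', j') + pell_mat n $$ (i', Suc j')"
    \<comment> \<open>This is Pascal's rule for C(i' + 1, m + 1), with 2^(i' - m) as common factor.
      If i' <= m, the exponent in the entry at (i', j') is truncated, but its binomial C(i', m + 1)
      is zero.\<close>
    proof (cases "i' \<le> m")
      case True
      then show ?thesis using ij i' n j' by (simp add: pell_mat_index binomial_eq_0)
    next
      case False
      then obtain d where "i' = Suc (m + d)"
        using less_iff_Suc_add by (metis not_le)
      then show ?thesis using ij i' n j' by (simp add: pell_mat_index algebra_simps)
    qed
    then show ?thesis using ij i' n j' by simp
  qed
  then show ?thesis
    using assms by (auto simp: pell_recurrence_def pell_mat_index binomial_eq_0)
qed

text \<open>The first row and the last column are prescribed, and every other entry is computed from
  the row above, so induction on the row determines the matrix.\<close>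

lemma pell_recurrence_unique:
  assumes B: "B \<in> carrier_mat n n" "pell_recurrence n B"
    and C: "C \<in> carrier_mat n n" "pell_recurrence n C"
  shows "B = C"
proof (rule eq_matI)
  have "B $$ (i, j) = C $$ (i, j)" if "i < n" "j < n" for i j
    using that
  proof (induction i arbitrary: j)
    case 0
    show ?case
    proof (cases "j = n - 1")
      case True
      then show ?thesis using 0 B C by (force simp: pell_recurrence_def)
    next
      case False
      then have "1 \<le> Suc j \<and> Suc j < n" using 0 by simp
      then have "entry B 1 (Suc j) = 0" "entry C 1 (Suc j) = 0"
        using B C unfolding pell_recurrence_def by blast+
      then show ?thesis by simp
    qed
  next
    case (Suc i)
    show ?case
    proof (cases "j = n - 1")
      case True
      have "1 \<le> Suc (Suc i) \<and> Suc (Suc i) \<le> n" using Suc.prems by simp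
      then have "entry B (Suc (Suc i)) n = entry C (Suc (Suc i)) n"
        using B C unfolding pell_recurrence_def by metis
      then show ?thesis using True by simp
    next
      case False
      then have "2 \<le> Suc (Suc i) \<and> Suc (Suc i) \<le> n \<and> 1 \<le> Suc j \<and> Suc j \<le> n - 1"
        using Suc.prems by auto
      then have "entry M (Suc (Suc i)) (Suc j)
          = 2 * entry M (Suc (Suc i) - 1) (Suc j) + entry M (Suc (Suc i) - 1) (Suc j + 1)"
        if "pell_recurrence n M" for M :: "'a mat"
        using that unfolding pell_recurrence_def by blast
      from this[OF B(2)] this[OF C(2)] show ?thesis
        using Suc False by simp
    qed
  qed
  then show "\<And>i j. i < dim_row C \<Longrightarrow> j < dim_col C \<Longrightarrow> B $$ (i, j) = C $$ (i, j)"
    using C by auto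
qed (use B C in auto)

theorem theorem3p1:
  fixes n :: nat
  assumes "n \<ge> 1"
  shows "(\<forall>e::nat. (pell_mat n ^\<^sub>m (e + 1)) *\<^sub>v pell_vec n
            = vec n (\<lambda>k. pell ((n - 1) * e + k)))
       \<and> (\<forall>e i j :: nat. 1 \<le> e \<and> 2 \<le> i \<and> i \<le> n \<and> 2 \<le> j \<and> j \<le> n \<longrightarrow>
            pell (e - 1) * entry (pell_mat n ^\<^sub>m e) i j
              + pell e * entry (pell_mat n ^\<^sub>m e) i (j - 1)
            = pell e * entry (pell_mat n ^\<^sub>m e) (i - 1) j
              + pell (e + 1) * entry (pell_mat n ^\<^sub>m e) (i - 1) (j - 1))
       \<and> (\<forall>B \<in> carrier_mat n n.
            pell_recurrence n B \<longleftrightarrow> B = (map_mat of_int (pell_mat n) :: 'a::comm_ring_1 mat))"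
proof (intro conjI allI impI ballI iffI)
  fix e
  show "(pell_mat n ^\<^sub>m (e + 1)) *\<^sub>v pell_vec n = vec n (\<lambda>k. pell ((n - 1) * e + k))"
    by (rule pell_mat_pow_mult_pell_vec)
next
  fix e i j :: nat
  assume "1 \<le> e \<and> 2 \<le> i \<and> i \<le> n \<and> 2 \<le> j \<and> j \<le> n"
  then show "pell (e - 1) * entry (pell_mat n ^\<^sub>m e) i j
        + pell e * entry (pell_mat n ^\<^sub>m e) i (j - 1)
      = pell e * entry (pell_mat n ^\<^sub>m e) (i - 1) j
        + pell (e + 1) * entry (pell_mat n ^\<^sub>m e) (i - 1) (j - 1)"
    using pell_mat_pow_recurrence by blast
next
  fix B :: "'a mat"
  assume "B \<in> carrier_mat n n" "pell_recurrence n B"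
  then show "B = map_mat of_int (pell_mat n)"
    using pell_recurrence_unique pell_recurrence_of_int_pell_mat[OF assms]
    by (metis map_carrier_mat pell_mat_carrier)
next
  fix B :: "'a mat"
  assume "B = map_mat of_int (pell_mat n)"
  then show "pell_recurrence n B"
    using pell_recurrence_of_int_pell_mat[OF assms] by simp
qed

end
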